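(* For every integer $n\geq 1$, define \[ V_{n}(x):=\frac{2(n+1)}{\binom{2n}{n}x^{n}(1-2x)}\left(Q_{n}(-x)^2-Q_{n-1}(-x)Q_{n+1}(-x)\right). \] Then \[ V_{n}(x)=\sum_{k=0}^{n-1}\frac{(n-k)(n-k+1)}{n}\binom{n-1+k}{k}x^{k}. \]
   Context: For each integer $m\geq 0$, $P_m(x),Q_m(x)\in\mathbb{Q}[x]$ denote the unique pair of polynomials with $\deg P_m\leq m$, $\deg Q_m\leq m$ satisfying $P_m(x)x^{m+1}+Q_m(x)(x+1)^{m+1}=1$. *)

theory Defs
  imports "HOL-Computational_Algebra.Computational_Algebra"
    "HOL-Computational_Algebra.Field_as_Ring"
begin

definition is_PQ :: "nat \<Rightarrow> rat poly \<times> rat poly \<Rightarrow> bool" where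
  "is_PQ m = (\<lambda>(p, q). degree p \<le> m \<and> degree q \<le> m \<and>
     p * [:0, 1:] ^ (m + 1) + q * ([:0, 1:] + 1) ^ (m + 1) = 1)"

definition PQ :: "nat \<Rightarrow> rat poly \<times> rat poly" where
  "PQ m = (THE pq. is_PQ m pq)"

definition P :: "nat \<Rightarrow> rat poly" where
  "P m = fst (PQ m)"

definition Q :: "nat \<Rightarrow> rat poly" where
  "Q m = snd (PQ m)"

(* V n lives in the field of rational functions over the rationals; [:0, 1:] is the indeterminate x
   and pcompose _ [:0, -1:] is the substitution of -x for x. *)
definition V :: "nat \<Rightarrow> rat poly fract" where
  "V n = to_fract [:2 * (of_nat n + 1):]
       / to_fract ([:of_nat ((2 * n) choose n):] * [:0, 1:] ^ n * (1 - 2 * [:0, 1:]))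
       * to_fract ((pcompose (Q n) [:0, -1:])\<^sup>2
           - pcompose (Q (n - 1)) [:0, -1:] * pcompose (Q (n + 1)) [:0, -1:])"

lemma coprime_X_X1: "coprime ([:0, 1:] ^ k :: rat poly) (([:0, 1:] + 1) ^ l)"
proof -
  have "coprime ([:0, 1:] :: rat poly) ([:0, 1:] + 1)"
  proof (rule coprimeI)
    fix c :: "rat poly"
    assume c: "c dvd [:0, 1:]" and "c dvd [:0, 1:] + 1"
    then have "c dvd ([:0, 1:] + 1) - [:0, 1:]" by (intro dvd_diff)
    then show "is_unit c" by (simp only: add_diff_cancel_left')
  qed
  then show ?thesis
    by (simp only: coprime_power_left_iff coprime_power_right_iff simp_thms)
qed

lemma degree_X_pow: "degree ([:0, 1:] ^ k :: rat poly) = k"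
  by (simp add: degree_power_eq)

lemma degree_X1_pow: "degree (([:0, 1:] + 1) ^ k :: rat poly) = k"
  by (simp add: degree_power_eq one_pCons)

lemma is_PQ_exists: "\<exists>pq. is_PQ m pq"
proof -
  define X :: "rat poly" where "X = [:0, 1:] ^ (m + 1)"
  define Y :: "rat poly" where "Y = ([:0, 1:] + 1) ^ (m + 1)"
  have dX: "degree X = m + 1" and dY: "degree Y = m + 1"
    unfolding X_def Y_def by (rule degree_X_pow degree_X1_pow)+
  have X0: "X \<noteq> 0" using dX by auto
  have "coprime X Y" unfolding X_def Y_def by (rule coprime_X_X1)
  then have "fst (bezout_coefficients X Y) * X + snd (bezout_coefficients X Y) * Y = 1"
    by (simp only: bezout_coefficients_fst_snd coprime_iff_gcd_eq_1)
  then obtain a b where ab: "a * X + b * Y = 1" by blast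
  define q where "q = b mod X"
  define p where "p = a + (b div X) * Y"
  have "p * X + q * Y = a * X + (b div X * X + b mod X) * Y"
    unfolding p_def q_def by (simp only: distrib_left distrib_right ac_simps)
  then have eq: "p * X + q * Y = 1" using ab by (simp only: div_mult_mod_eq)
  have dq: "degree q \<le> m"
    using degree_mod_less[OF X0, of b] dX by (auto simp: q_def)
  have dp: "degree p \<le> m"
  proof (cases "p = 0")
    case False
    have "degree p + degree X = degree (p * X)"
      using False X0 by (simp add: degree_mult_eq)
    also have "p * X = 1 - q * Y" using eq by (simp add: algebra_simps)
    also have "degree (1 - q * Y) \<le> m + (m + 1)"
      using degree_mult_le[of q Y] dq dY by (intro degree_diff_le) auto
    finally show ?thesis using dX by simp
  qed simp
  have "is_PQ m (p, q)"
    using eq dp dq by (simp add: is_PQ_def X_def Y_def)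
  then show ?thesis ..
qed

lemma is_PQ_unique:
  assumes "is_PQ m pq" and "is_PQ m pq'"
  shows "pq = pq'"
proof -
  define X :: "rat poly" where "X = [:0, 1:] ^ (m + 1)"
  define Y :: "rat poly" where "Y = ([:0, 1:] + 1) ^ (m + 1)"
  have dX: "degree X = m + 1" unfolding X_def by (rule degree_X_pow)
  then have X0: "X \<noteq> 0" by auto
  obtain p q p' q' where pq: "pq = (p, q)" "pq' = (p', q')" by (cases pq, cases pq')
  have d: "degree q \<le> m" "degree q' \<le> m"
    and e: "p * X + q * Y = 1" "p' * X + q' * Y = 1"
    using assms by (auto simp: pq is_PQ_def X_def Y_def)
  have h: "(p - p') * X = (q' - q) * Y" using e by (simp add: algebra_simps)
  have "coprime X Y" unfolding X_def Y_def by (rule coprime_X_X1)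
  moreover have "X dvd (q' - q) * Y" using h by (metis dvd_triv_right)
  ultimately have "X dvd q' - q" by (simp add: coprime_dvd_mult_left_iff)
  moreover have "degree (q' - q) < degree X"
    using degree_diff_le[OF d(2) d(1)] dX by simp
  ultimately have "q' - q = 0"
    using dvd_imp_degree_le[of X "q' - q"] by (auto simp del: right_minus_eq)
  with h X0 show ?thesis by (simp add: pq)
qed

lemma is_PQ_ex1: "\<exists>!pq. is_PQ m pq"
  using is_PQ_exists is_PQ_unique by blast

lemma is_PQ_P_Q: "is_PQ m (P m, Q m)"
  using theI'[OF is_PQ_ex1, of m] by (simp add: P_def Q_def PQ_def)

end

theory Submission
  imports Defs
begin

text \<open>
  Put \<open>q\<^sub>m(x) = Q\<^sub>m(-x)\<close> and \<open>c\<^sub>m = (2m choose m)\<close>. Then \<open>q\<^sub>m\<close> is the truncation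
  \<open>\<Sum>k\<le>m. (m+k choose k) x^k\<close> of \<open>(1-x)^(-m-1)\<close>, and it satisfies
  \<open>(1-x) q\<^sub>m = q\<^sub>m\<^sub>-\<^sub>1 + c\<^sub>m/2 x^m (1-2x)\<close>. After multiplication by \<open>(1-x)^m\<close> the
  correction term is antisymmetric under \<open>x \<mapsto> 1-x\<close>, which gives the Bezout identity
  \<open>(1-x)^(m+1) q\<^sub>m(x) + x^(m+1) q\<^sub>m(1-x) = 1\<close> by induction. Eliminating \<open>q\<^sub>n\<^sub>-\<^sub>1\<close> and
  \<open>q\<^sub>n\<^sub>+\<^sub>1\<close> from \<open>(1-x)(q\<^sub>n\<^sup>2 - q\<^sub>n\<^sub>-\<^sub>1 q\<^sub>n\<^sub>+\<^sub>1)\<close> shows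
  \<open>(1-x) V\<^sub>n = (n+1 - 2(2n+1)x(1-x)) q\<^sub>n + (2n+1) c\<^sub>n x^(n+1) (1-2x)\<close>,
  and the claimed sum satisfies the same equation.
\<close>

text \<open>Values at rational points instead of a polynomial: the identities below become plain
  field arithmetic, and agreement at all rationals later gives equality of polynomials.\<close>

definition trunc :: "nat \<Rightarrow> rat \<Rightarrow> rat" where
  "trunc m x = (\<Sum>k\<le>m. of_nat ((m + k) choose k) * x ^ k)"

text \<open>Pascal's rule lowers the parameter \<open>Suc m\<close> to \<open>m\<close>; the
  subtracted term is what the cutoff leaves over. The cutoff \<open>N\<close> is independent of
  \<open>m\<close> so that induction on it is possible.\<close>

lemma one_minus_times_binomial_sum:
  fixes x :: rat
  shows "(1 - x) * (\<Sum>k\<le>N. of_nat ((Suc m + k) choose k) * x ^ k) =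
    (\<Sum>k\<le>N. of_nat ((m + k) choose k) * x ^ k) - of_nat ((Suc m + N) choose N) * x ^ Suc N"
proof (induction N)
  case (Suc N)
  have "(Suc m + Suc N) choose Suc N = ((Suc m + N) choose N) + ((m + Suc N) choose Suc N)"
    by simp
  then have "of_nat ((Suc m + Suc N) choose Suc N) =
      (of_nat ((Suc m + N) choose N) + of_nat ((m + Suc N) choose Suc N) :: rat)"
    by (metis of_nat_add)
  with Suc.IH show ?case
    unfolding sum.atMost_Suc distrib_left by (simp add: algebra_simps)
qed simp

lemma central_binomial_Suc: "(2 * Suc m) choose Suc m = 2 * ((2 * m + 1) choose Suc m)"
  using binomial_symmetric[of m "2 * m + 1"] by simp

text \<open>With cutoff \<open>Suc m\<close>, the top term of the sum and the leftover have
  coefficients \<open>d\<close> and \<open>2 * d\<close>, where \<open>d\<close> is half the central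
  binomial coefficient; together they give the factor \<open>1 - 2 * x\<close>.\<close>

lemma trunc_Suc:
  "(1 - x) * trunc (Suc m) x =
    trunc m x + of_nat ((2 * m + 1) choose Suc m) * x ^ Suc m * (1 - 2 * x)"
proof -
  have "of_nat ((Suc m + Suc m) choose Suc m) = (2 * of_nat ((2 * m + 1) choose Suc m) :: rat)"
    using central_binomial_Suc[of m] by (metis mult_2 of_nat_mult of_nat_numeral)
  moreover have "m + Suc m = 2 * m + 1" by simp
  ultimately show ?thesis
    unfolding trunc_def one_minus_times_binomial_sum
    by (simp only: sum.atMost_Suc power_Suc) (simp only: algebra_simps mult_2)
qed

lemma trunc_bezout: "(1 - x) ^ Suc m * trunc m x + x ^ Suc m * trunc m (1 - x) = 1"
proof (induction m)
  case 0
  show ?case by (simp add: trunc_def)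
next
  case (Suc m)
  have "(1 - x) ^ Suc (Suc m) * trunc (Suc m) x = (1 - x) ^ Suc m * ((1 - x) * trunc (Suc m) x)"
    by simp
  \<comment> \<open>Writing one factor \<open>x\<close> as \<open>1 - (1 - x)\<close> makes
    \<open>trunc_Suc\<close> applicable at \<open>1 - x\<close>.\<close>
  moreover have "x ^ Suc (Suc m) * trunc (Suc m) (1 - x) =
      x ^ Suc m * ((1 - (1 - x)) * trunc (Suc m) (1 - x))"
    by simp
  ultimately show ?case
    using Suc.IH unfolding trunc_Suc by (simp add: algebra_simps)
qed

definition trunc_poly :: "nat \<Rightarrow> rat poly" where
  "trunc_poly m = (\<Sum>k\<le>m. monom (of_nat ((m + k) choose k)) k)"

lemma poly_trunc_poly: "poly (trunc_poly m) x = trunc m x"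
  by (simp add: trunc_poly_def trunc_def poly_sum poly_monom)

lemma degree_trunc_poly: "degree (trunc_poly m) \<le> m"
  unfolding trunc_poly_def by (intro degree_sum_le) (auto intro: order_trans[OF degree_monom_le])

lemma poly_Q: "poly (Q m) x = trunc m (- x)"
proof -
  define q where "q = pcompose (trunc_poly m) [:0, -1:]"
  \<comment> \<open>The Bezout identity is used at \<open>- x\<close>; the scalar absorbs the sign
    of \<open>(- x) ^ Suc m\<close>.\<close>
  define p where "p = smult ((-1) ^ Suc m) (pcompose (trunc_poly m) [:1, 1:])"
  have "poly (p * [:0, 1:] ^ (m + 1) + q * ([:0, 1:] + 1) ^ (m + 1)) x = poly 1 x" for x
    using trunc_bezout[of "- x" m]
    by (simp add: p_def q_def poly_pcompose poly_trunc_poly power_minus[of x] ac_simps)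
  then have "p * [:0, 1:] ^ (m + 1) + q * ([:0, 1:] + 1) ^ (m + 1) = 1"
    by (simp only: poly_eq_poly_eq_iff[symmetric] fun_eq_iff) blast
  moreover have "degree p \<le> m" "degree q \<le> m"
    using degree_trunc_poly[of m] by (simp_all add: p_def q_def degree_pcompose)
  ultimately have "is_PQ m (p, q)"
    by (simp add: is_PQ_def)
  then have "Q m = q"
    using is_PQ_unique[OF is_PQ_P_Q] by blast
  then show ?thesis
    by (simp add: q_def poly_pcompose poly_trunc_poly)
qed

text \<open>The remainder is explicit for every cutoff, so induction on \<open>N\<close> suffices.
  At \<open>N = Suc m\<close> its last factor becomes \<open>(2 * n + 1) * (1 - 2 * x)\<close>, the
  form needed later.\<close>

lemma one_minus_times_weighted_sum:
  fixes x :: rat and m :: nat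
  defines "n \<equiv> of_nat (Suc m) :: rat"
  shows "(1 - x) * (\<Sum>k\<le>N. (n - of_nat k) * (n - of_nat k + 1) / n * of_nat ((m + k) choose k) * x ^ k) =
    (n + 1 - 2 * (2 * n + 1) * x * (1 - x)) * (\<Sum>k\<le>N. of_nat ((Suc m + k) choose k) * x ^ k)
    + x ^ Suc N * of_nat ((Suc m + N) choose N) *
      (3 * n - of_nat N + 1 - 2 * (2 * n + 1) * x)"
proof (induction N)
  case 0
  have "n \<noteq> 0" by (simp add: n_def)
  then show ?case by (simp add: field_simps)
next
  case (Suc N)
  define a where "a = (of_nat ((Suc m + N) choose N) :: rat)"
  define r where "r = (of_nat N :: rat)"
  have n0: "n > 0" and r0: "r \<ge> 0" by (simp_all add: n_def r_def)
  \<comment> \<open>The three binomials of the step are \<open>(r + 1) * t\<close>,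
    \<open>(n + r + 1) * t\<close> and \<open>n * t\<close>; the last one cancels the division by
    \<open>n\<close>, leaving a polynomial identity.\<close>
  define t where "t = a / (r + 1)"
  have a: "a = (r + 1) * t" using r0 by (simp add: t_def)
  have "Suc N * ((Suc m + Suc N) choose Suc N) = (Suc m + Suc N) * ((Suc m + N) choose N)"
    using Suc_times_binomial_eq[of "Suc m + N" N] by (simp add: ac_simps)
  then have "of_nat (Suc N) * of_nat ((Suc m + Suc N) choose Suc N) = of_nat (Suc m + Suc N) * a"
    unfolding a_def by (simp only: of_nat_mult[symmetric])
  moreover have "of_nat (Suc N) = r + 1" "of_nat (Suc m + Suc N) = n + r + 1"
    by (simp_all add: r_def n_def)
  ultimately have "(r + 1) * of_nat ((Suc m + Suc N) choose Suc N) = (n + r + 1) * a"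
    by (simp only:)
  then have a1: "of_nat ((Suc m + Suc N) choose Suc N) = (n + r + 1) * t"
    using r0 by (simp add: t_def eq_divide_eq mult.commute del: binomial_Suc_Suc)
  have "((m + Suc N) choose Suc N) + ((Suc m + N) choose N) = (Suc m + Suc N) choose Suc N"
    by simp
  then have "of_nat ((m + Suc N) choose Suc N) + a = of_nat ((Suc m + Suc N) choose Suc N)"
    unfolding a_def by (metis of_nat_add)
  then have b1: "of_nat ((m + Suc N) choose Suc N) = n * t"
    unfolding a1 a by (simp only: distrib_right)
  have s: "of_nat (Suc N) = r + 1" by (simp add: r_def)
  define y where "y = x ^ Suc N"
  have "(n - (r + 1)) * (n - (r + 1) + 1) / n * (n * t) = (n - (r + 1)) * (n - r) * t"
    using n0 by simp
  then have step: "(1 - x) * ((n - (r + 1)) * (n - (r + 1) + 1) / n * (n * t) * y) =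
    (n + 1 - 2 * (2 * n + 1) * x * (1 - x)) * ((n + r + 1) * t * y)
    + x * y * ((n + r + 1) * t) * (3 * n - (r + 1) + 1 - 2 * (2 * n + 1) * x)
    - y * a * (3 * n - r + 1 - 2 * (2 * n + 1) * x)"
    unfolding a by (simp only:) (simp add: algebra_simps)
  show ?case
    using Suc.IH step
    unfolding sum.atMost_Suc s a1 b1 distrib_left[of "1 - x"]
      distrib_left[of "n + 1 - 2 * (2 * n + 1) * x * (1 - x)"]
    unfolding power_Suc[of x "Suc N"] y_def[symmetric] a_def[symmetric] r_def[symmetric]
    by linarith
qed

text \<open>The factor \<open>1 - x\<close> stays on both sides because it may vanish at the point
  \<open>x\<close>; it is cancelled only between polynomials.\<close>

lemma trunc_turan_identity:
  fixes x :: rat and m :: nat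
  defines "n \<equiv> of_nat (Suc m) :: rat"
  shows "(1 - x) * (2 * (n + 1) * ((trunc (Suc m) x)\<^sup>2 - trunc m x * trunc (Suc (Suc m)) x)) =
    (1 - x) * (of_nat ((2 * Suc m) choose Suc m) * x ^ Suc m * (1 - 2 * x) *
      (\<Sum>k\<le>m. (n - of_nat k) * (n - of_nat k + 1) / n * of_nat ((m + k) choose k) * x ^ k))"
proof -
  define c where "c = (of_nat ((2 * Suc m) choose Suc m) :: rat)"
  define d where "d = (of_nat ((2 * m + 1) choose Suc m) :: rat)"
  define e where "e = (of_nat ((2 * Suc m + 1) choose Suc (Suc m)) :: rat)"
  define y where "y = x ^ Suc m"
  define A where "A = trunc (Suc m) x"
  define B where "B = trunc m x"
  define C where "C = trunc (Suc (Suc m)) x"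
  define W where "W = (\<Sum>k\<le>m. (n - of_nat k) * (n - of_nat k + 1) / n * of_nat ((m + k) choose k) * x ^ k)"
  have cd: "c = 2 * d"
    unfolding c_def d_def central_binomial_Suc by simp
  \<comment> \<open>The factor \<open>n + 1\<close> in the definition of \<open>V\<close> turns
    \<open>e\<close> into a multiple of \<open>c\<close>.\<close>
  have "Suc (Suc m) * ((2 * Suc m + 1) choose Suc (Suc m)) = (2 * Suc m + 1) * ((2 * Suc m) choose Suc m)"
    using Suc_times_binomial_eq[of "2 * Suc m" "Suc m"] by (simp add: ac_simps)
  then have "of_nat (Suc (Suc m)) * e = of_nat (2 * Suc m + 1) * c"
    unfolding e_def c_def by (metis of_nat_mult)
  then have ce: "(n + 1) * e = (2 * n + 1) * c"
    by (simp add: n_def algebra_simps)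
  have AB: "(1 - x) * A = B + d * y * (1 - 2 * x)"
    unfolding A_def B_def d_def y_def by (rule trunc_Suc)
  have CA: "(1 - x) * C = A + e * (x * y) * (1 - 2 * x)"
    unfolding A_def C_def e_def y_def power_Suc[of x "Suc m", symmetric] by (rule trunc_Suc)
  have W: "(1 - x) * W = (n + 1 - 2 * (2 * n + 1) * x * (1 - x)) * A + (2 * n + 1) * c * (x * y) * (1 - 2 * x)"
  proof -
    \<comment> \<open>The added term vanishes through \<open>n - of_nat k\<close>, and the range now
      matches that of \<open>A\<close>.\<close>
    have "W = (\<Sum>k\<le>Suc m. (n - of_nat k) * (n - of_nat k + 1) / n * of_nat ((m + k) choose k) * x ^ k)"
      by (simp add: W_def n_def)
    moreover have "Suc m + Suc m = 2 * Suc m" by simp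
    ultimately show ?thesis
      using one_minus_times_weighted_sum[of x m "Suc m", folded n_def]
      unfolding A_def trunc_def c_def y_def by (simp only: power_Suc) (simp add: algebra_simps)
  qed
  have "(1 - x) * (2 * (n + 1) * (A\<^sup>2 - B * C)) = (1 - x) * (c * y * (1 - 2 * x) * W)"
  proof -
    have B: "B = (1 - x) * A - d * y * (1 - 2 * x)" using AB by simp
    have "(1 - x) * (2 * (n + 1) * (A\<^sup>2 - B * C)) =
        2 * (n + 1) * ((1 - x) * A\<^sup>2 - B * ((1 - x) * C))"
      by (simp add: algebra_simps)
    \<comment> \<open>By \<open>AB\<close>, \<open>(1 - x) * A\<^sup>2 - B * A\<close> collapses to
      \<open>d * y * (1 - 2 * x) * A\<close>, so every term carries
      \<open>y * (1 - 2 * x)\<close>.\<close>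
    also have "\<dots> = 2 * (n + 1) * d * y * (1 - 2 * x) * A
        - 2 * ((n + 1) * e) * (x * y) * (1 - 2 * x) * ((1 - x) * A - d * y * (1 - 2 * x))"
      unfolding CA B by (simp add: algebra_simps power2_eq_square)
    also have "\<dots> = c * y * (1 - 2 * x) * ((1 - x) * W)"
      unfolding ce W cd by (simp add: algebra_simps)
    finally show ?thesis by (simp add: ac_simps)
  qed
  then show ?thesis
    unfolding A_def B_def C_def W_def c_def y_def .
qed

theorem theorem7p2:
  fixes n :: nat
  assumes "n \<ge> 1"
  shows "V n = to_fract (\<Sum>k = 0..n - 1.
           [:(of_nat n - of_nat k) * (of_nat n - of_nat k + 1) / of_nat n
              * of_nat ((n - 1 + k) choose k):] * [:0, 1:] ^ k)"
proof -
  obtain m where n: "n = Suc m" using assms by (cases n) auto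
  define W :: "rat poly" where "W = (\<Sum>k = 0..n - 1.
           [:(of_nat n - of_nat k) * (of_nat n - of_nat k + 1) / of_nat n
              * of_nat ((n - 1 + k) choose k):] * [:0, 1:] ^ k)"
  define D :: "rat poly" where "D = (pcompose (Q n) [:0, -1:])\<^sup>2
           - pcompose (Q (n - 1)) [:0, -1:] * pcompose (Q (n + 1)) [:0, -1:]"
  define E :: "rat poly" where "E = [:of_nat ((2 * n) choose n):] * [:0, 1:] ^ n * (1 - 2 * [:0, 1:])"
  have W: "poly W x = (\<Sum>k\<le>m. (of_nat (Suc m) - of_nat k) * (of_nat (Suc m) - of_nat k + 1)
      / of_nat (Suc m) * of_nat ((m + k) choose k) * x ^ k)" for x
    unfolding W_def n poly_sum poly_mult poly_power
    by (simp add: atMost_atLeast0 mult.commute)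
  have "poly ([:1, -1:] * ([:2 * (of_nat n + 1):] * D)) x = poly ([:1, -1:] * (E * W)) x" for x
  proof -
    have "poly [:1, -1:] x = 1 - x" by simp
    moreover have "poly [:2 * (of_nat n + 1):] x = 2 * (of_nat (Suc m) + 1)" by (simp add: n)
    moreover have "poly D x = (trunc (Suc m) x)\<^sup>2 - trunc m x * trunc (Suc (Suc m)) x"
      by (simp add: D_def n poly_pcompose poly_Q)
    moreover have "poly E x = of_nat ((2 * Suc m) choose Suc m) * x ^ Suc m * (1 - 2 * x)"
      unfolding E_def n poly_mult poly_power poly_diff by simp
    ultimately show ?thesis
      unfolding poly_mult W by (simp only: trunc_turan_identity)
  qed
  then have "[:1, -1:] * ([:2 * (of_nat n + 1):] * D) = [:1, -1:] * (E * W)"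
    by (simp only: poly_eq_poly_eq_iff[symmetric] fun_eq_iff) blast
  \<comment> \<open>Here \<open>1 - x\<close> is a nonzero element of an integral domain, so no
    point has to be excluded.\<close>
  then have eq: "[:2 * (of_nat n + 1):] * D = E * W"
    by (subst (asm) mult_left_cancel) simp_all
  have "(1 - 2 * [:0, 1:] :: rat poly) \<noteq> 0"
  proof
    assume "(1 - 2 * [:0, 1:] :: rat poly) = 0"
    then have "poly (1 - 2 * [:0, 1:] :: rat poly) 0 = 0" by simp
    then show False by simp
  qed
  moreover have "[:of_nat ((2 * n) choose n):] \<noteq> (0 :: rat poly)" by simp
  ultimately have "E \<noteq> 0" unfolding E_def by simp
  have "V n = to_fract [:2 * (of_nat n + 1):] / to_fract E * to_fract D"
    unfolding V_def D_def E_def ..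
  also have "\<dots> = to_fract ([:2 * (of_nat n + 1):] * D) / to_fract E"
    by (simp only: to_fract_mult times_divide_eq_left)
  also have "\<dots> = to_fract W"
    unfolding eq to_fract_mult using \<open>E \<noteq> 0\<close> by simp
  finally show ?thesis unfolding W_def .
qed

end
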